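(* Let $K$ be a compact set in $\mathbb{R}^d$ such that $B(K)$ is also the minimum volume ellipsoid containing $K$. If there is a closed half-sphere $D \subset \partial B(K)$ such that $K \cap D$ has measure $0$ under the Haar measure of $\partial B(K)$, then the family $\mathcal{W}_{\mathrm{aff}}(K)$ does not admit an exact Helly theorem for the volume.
   Context: For a compact set $K\subset\mathbb{R}^d$, $B(K)$ denotes the minimum volume ball such that $K\subset B(K)$, and $\partial B(K)$ is its boundary. The Haar measure of $\partial B(K)$ is the rotation-invariant probability measure on this sphere. If $c$ is the center of $B(K)$, a closed half-sphere of $\partial B(K)$ is a set of the form $\{x\in\partial B(K): \langle x-c,u\rangle\ge 0\}$ with $u$ a unit vector. $SL(d)$ is the group of real $d\times d$ matrices of determinant $1$, and for a matrix $A$, $AK=\{Ax: x\in K\}$. The family of affine copies of $K$ is $$\mathcal{W}_{\mathrm{aff}}(K)=\{a+\alpha AK : A\in SL(d),\ \alpha\in\mathbb{R},\ a\in\mathbb{R}^d\}.$$ For a family $\mathcal{W}$ of sets in $\mathbb{R}^d$, the Helly number $h(\mathcal{W})$ is the smallest positive integer $n$, if it exists, such that for every finite family $\mathcal{F}$ of convex sets in $\mathbb{R}^d$: if the intersection of every $n$ or fewer sets of $\mathcal{F}$ contains a set of $\mathcal{W}$, then $\bigcap\mathcal{F}$ contains a set of $\mathcal{W}$. If no such $n$ exists, $h(\mathcal{W})=\infty$. The family $\mathcal{W}$ admits an exact Helly theorem for the volume if $h(\mathcal{W}')<\infty$, where $\mathcal{W}'=\{W\in\mathcal{W}: \operatorname{vol}(W)\ge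 1\}$. *)

theory Defs
  imports "HOL-Analysis.Analysis" "HOL-Probability.Probability" "HOL-Library.Extended_Nat"
begin

definition is_ball :: "(real ^ 'n) set \<Rightarrow> bool" where
  "is_ball B \<longleftrightarrow> (\<exists>c r. 0 \<le> r \<and> B = cball c r)"

definition is_ellipsoid :: "(real ^ 'n) set \<Rightarrow> bool" where
  "is_ellipsoid E \<longleftrightarrow>
     (\<exists>a (M :: real ^ 'n ^ 'n). invertible M \<and> E = (\<lambda>x. a + M *v x) ` cball 0 1)"

definition min_volume_ball :: "(real ^ 'n) set \<Rightarrow> (real ^ 'n) set \<Rightarrow> bool" where
  "min_volume_ball K B \<longleftrightarrow> is_ball B \<and> K \<subseteq> B \<and>
     (\<forall>B'. is_ball B' \<and> K \<subseteq> B' \<longrightarrow> measure lebesgue B \<le> measure lebesgue B')"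

definition min_volume_ellipsoid :: "(real ^ 'n) set \<Rightarrow> (real ^ 'n) set \<Rightarrow> bool" where
  "min_volume_ellipsoid K E \<longleftrightarrow> is_ellipsoid E \<and> K \<subseteq> E \<and>
     (\<forall>E'. is_ellipsoid E' \<and> K \<subseteq> E' \<longrightarrow> measure lebesgue E \<le> measure lebesgue E')"

text \<open>Invariance is required under the full orthogonal group. In dimension at least 2 this is
  equivalent to invariance under orientation-preserving rotations; in dimension 1 the latter are
  trivial and would not determine the measure.\<close>

definition sphere_haar :: "real ^ 'n \<Rightarrow> real \<Rightarrow> (real ^ 'n) measure \<Rightarrow> bool" where
  "sphere_haar c r \<sigma> \<longleftrightarrow> prob_space \<sigma> \<and>
     sets \<sigma> = sets (restrict_space borel (sphere c r)) \<and>
     (\<forall>f. orthogonal_transformation f \<longrightarrow> distr \<sigma> \<sigma> (\<lambda>x. c + f (x - c)) = \<sigma>)"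

definition closed_half_sphere :: "real ^ 'n \<Rightarrow> real \<Rightarrow> real ^ 'n \<Rightarrow> (real ^ 'n) set" where
  "closed_half_sphere c r u = {x \<in> sphere c r. 0 \<le> (x - c) \<bullet> u}"

definition affine_copies :: "(real ^ 'n) set \<Rightarrow> (real ^ 'n) set set" where
  "affine_copies K =
     {(\<lambda>x. a + \<alpha> *\<^sub>R (A *v x)) ` K | a \<alpha> (A :: real ^ 'n ^ 'n). det A = 1}"

definition contains_member :: "(real ^ 'n) set set \<Rightarrow> (real ^ 'n) set \<Rightarrow> bool" where
  "contains_member \<W> C \<longleftrightarrow> (\<exists>W\<in>\<W>. W \<subseteq> C)"

text \<open>The subfamilies are nonempty, whereas the family itself may be empty, with intersection
  the whole space. This matters only when \<open>\<W>\<close> has no members at all: its Helly number is then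
  infinite. For nonempty \<open>\<W>\<close> the treatment of empty (sub)families is immaterial.\<close>

definition helly_property :: "(real ^ 'n) set set \<Rightarrow> nat \<Rightarrow> bool" where
  "helly_property \<W> n \<longleftrightarrow>
     (\<forall>\<F>. finite \<F> \<and> (\<forall>C\<in>\<F>. convex C) \<and>
        (\<forall>\<G>\<subseteq>\<F>. \<G> \<noteq> {} \<and> card \<G> \<le> n \<longrightarrow> contains_member \<W> (\<Inter>\<G>))
        \<longrightarrow> contains_member \<W> (\<Inter>\<F>))"

text \<open>In \<^typ>\<open>enat\<close> the infimum of the empty set is \<open>\<infinity>\<close>.\<close>

definition helly_number :: "(real ^ 'n) set set \<Rightarrow> enat" where
  "helly_number \<W> = Inf (enat ` {n. 1 \<le> n \<and> helly_property \<W> n})"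

definition exact_helly_for_volume :: "(real ^ 'n) set set \<Rightarrow> bool" where
  "exact_helly_for_volume \<W> \<longleftrightarrow> helly_number {W \<in> \<W>. 1 \<le> emeasure lebesgue W} < \<infinity>"

end

theory Submission
  imports Defs
begin

text \<open>
  Write \<open>L\<close> for \<open>K\<close> rescaled so that its ball is the unit ball, and let \<open>h\<close> be the threshold
  in the family \<open>H x = {y. x \<bullet> y \<le> h}\<close>, where \<open>x\<close> runs over a finite net of the unit sphere.

  The intersection of the whole family is nearly a ball, and an affine copy of \<open>K\<close> inside a ball of
  radius \<open>s\<close> has volume at most \<open>(s / r)^d\<close> times that of \<open>K\<close>: pulling the ball of
  radius \<open>s\<close> back along the affine map gives an ellipsoid around \<open>K\<close>, whose volume is at least
  that of the minimal one, \<open>cball c r\<close> (\<open>measure_copy_in_cball_le\<close>).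

  An intersection of only \<open>n\<close> of the half-spaces leaves room for a copy that is larger by a factor
  depending on \<open>n\<close> alone. The contact points of \<open>L\<close> with the unit sphere that lie in the closed
  half-sphere given by \<open>u\<close> form a closed set of Haar measure \<open>0\<close>, so they have empty interior in
  the sphere, and some rotation moves \<open>n\<close> prescribed normals off them
  (\<open>rotation_avoiding_codense_set\<close>). Equivalently, one rotates \<open>L\<close>. In the direction of a normal
  in the closed half-sphere, \<open>L\<close> then does not reach the sphere at all; in the direction of any
  other normal it may touch, but a small translation along \<open>u\<close> pulls it off the tangent hyperplane.
  Hence the moved copy lies strictly inside all \<open>n\<close> half-spaces tangent to the unit ball
  (\<open>rotation_into_open_halfspaces\<close>). Compactness of the space of sequences of normals turns
  strictness into one bound \<open>m < 1\<close> valid for every choice of \<open>n\<close> normals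
  (\<open>uniform_rotation_into_halfspaces\<close>).

  Scaling so that a copy of volume exactly \<open>1\<close> fits every \<open>n\<close>-fold intersection, and choosing the
  net fine enough in terms of \<open>m\<close>, makes every copy in the total intersection have volume less than
  \<open>1\<close>. So no \<open>n\<close> is a Helly number. If \<open>K\<close> has volume \<open>0\<close>, no copy has volume at least \<open>1\<close>, and
  the empty family \<open>\<F>\<close> already violates the Helly property.

  Volumes of linear images enter only through ratios: a linear bijection scales all compact sets by
  the same factor (\<open>measure_matrix_image_ratio\<close>). Comparing with balls then identifies the factor
  for rotations and bounds it for copies inside a ball.
\<close>

section \<open>Linear bijections scale all volumes by the same factor\<close>

lemma nn_integral_lborel_shift:
  fixes h :: "'a::euclidean_space \<Rightarrow> ennreal"
  assumes [measurable]: "h \<in> borel_measurable borel"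
  shows "(\<integral>\<^sup>+x. h (a + x) \<partial>lborel) = (\<integral>\<^sup>+x. h x \<partial>lborel)"
proof -
  have "(\<integral>\<^sup>+x. h x \<partial>lborel) = (\<integral>\<^sup>+x. h x \<partial>distr lborel borel ((+) a))"
    by (simp add: lborel_distr_plus)
  then show ?thesis
    by (simp add: nn_integral_distr)
qed

lemma nn_integral_lborel_reflect:
  fixes h :: "'a::euclidean_space \<Rightarrow> ennreal"
  assumes [measurable]: "h \<in> borel_measurable borel"
  shows "(\<integral>\<^sup>+x. h (a - x) \<partial>lborel) = (\<integral>\<^sup>+x. h x \<partial>lborel)"
proof -
  have "lborel = distr lborel borel (\<lambda>x::'a. a - x)"
    using lborel_affine[of "-1" a] by (simp add: density_1)
  then have "(\<integral>\<^sup>+x. h x \<partial>lborel) = (\<integral>\<^sup>+x. h x \<partial>distr lborel borel (\<lambda>x. a - x))"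
    by simp
  then show ?thesis
    by (simp add: nn_integral_distr)
qed

text \<open>This is the uniqueness argument for Haar measure, applied to Lebesgue measure and its image under
  \<open>g\<close>. The double integral of \<open>indicator B (g z) * indicator C (g z + x)\<close> is evaluated in two ways:
  translating \<open>x\<close> separates the factors at once, while translating \<open>z\<close> by \<open>f x\<close> and then reflecting
  \<open>x\<close> separates them with the roles of \<open>B\<close> and \<open>C\<close> exchanged.\<close>

lemma emeasure_linear_image_ratio:
  fixes f g :: "'a::euclidean_space \<Rightarrow> 'a"
  assumes lin: "linear f" "linear g"
    and inv: "\<And>x. f (g x) = x" "\<And>x. g (f x) = x"
    and [measurable]: "B \<in> sets borel" "C \<in> sets borel"
  shows "emeasure lborel (f ` B) * emeasure lborel C = emeasure lborel (f ` C) * emeasure lborel B"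
proof -
  have [measurable]: "g \<in> borel_measurable borel"
    by (simp add: lin borel_measurable_continuous_onI linear_continuous_on linear_conv_bounded_linear[symmetric])
  have vol: "emeasure lborel (f ` S) = (\<integral>\<^sup>+z. indicator S (g z) \<partial>lborel)"
    if [measurable]: "S \<in> sets borel" for S
  proof -
    have "f ` S = g -` S \<inter> space borel"
      using inv by (auto simp: image_iff) metis
    then have "f ` S \<in> sets borel"
      using measurable_sets[OF \<open>g \<in> borel_measurable borel\<close> that] by simp
    then have "emeasure lborel (f ` S) = (\<integral>\<^sup>+z. indicator (f ` S) z \<partial>lborel)"
      by simp
    also have "\<dots> = (\<integral>\<^sup>+z. indicator S (g z) \<partial>lborel)"
      using inv by (intro nn_integral_cong) (auto simp: indicator_def image_iff, metis)
    finally show ?thesis .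
  qed
  have "emeasure lborel (f ` B) * emeasure lborel C
      = (\<integral>\<^sup>+z. indicator B (g z) * emeasure lborel C \<partial>lborel)"
    by (simp add: vol nn_integral_multc)
  also have "\<dots> = (\<integral>\<^sup>+z. (\<integral>\<^sup>+x. indicator B (g z) * indicator C (g z + x) \<partial>lborel) \<partial>lborel)"
    by (simp add: nn_integral_cmult nn_integral_lborel_shift[of "indicator C"])
  also have "\<dots> = (\<integral>\<^sup>+x. (\<integral>\<^sup>+z. indicator B (g z) * indicator C (g z + x) \<partial>lborel) \<partial>lborel)"
    by (rule lborel_pair.Fubini'[symmetric]) simp
  also have "\<dots> = (\<integral>\<^sup>+x. (\<integral>\<^sup>+z. indicator B (g (- f x + z)) * indicator C (g (- f x + z) + x) \<partial>lborel) \<partial>lborel)"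
    by (intro nn_integral_cong nn_integral_lborel_shift[symmetric]) simp
  also have "\<dots> = (\<integral>\<^sup>+x. (\<integral>\<^sup>+z. indicator B (g z - x) * indicator C (g z) \<partial>lborel) \<partial>lborel)"
    by (simp add: linear_diff[OF lin(2)] inv)
  also have "\<dots> = (\<integral>\<^sup>+z. (\<integral>\<^sup>+x. indicator B (g z - x) * indicator C (g z) \<partial>lborel) \<partial>lborel)"
    by (rule lborel_pair.Fubini') simp
  also have "\<dots> = (\<integral>\<^sup>+z. emeasure lborel B * indicator C (g z) \<partial>lborel)"
    by (simp add: nn_integral_multc nn_integral_lborel_reflect[of "indicator B"])
  also have "\<dots> = emeasure lborel (f ` C) * emeasure lborel B"
    by (simp add: vol nn_integral_cmult mult.commute)
  finally show ?thesis .
qed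

lemma measure_matrix_image_ratio:
  fixes M :: "real^'n^'n"
  assumes "invertible M" "compact S" "compact T"
  shows "measure lebesgue ((*v) M ` S) * measure lebesgue T
       = measure lebesgue ((*v) M ` T) * measure lebesgue S"
proof -
  obtain N where N: "M ** N = mat 1" "N ** M = mat 1"
    using assms(1) by (auto simp: invertible_def)
  have inv: "M *v (N *v x) = x" "N *v (M *v x) = x" for x
    by (simp_all add: matrix_vector_mul_assoc N)
  have comp: "compact ((*v) M ` U)" if "compact U" for U
    using that by (intro compact_continuous_image matrix_vector_mult_linear_continuous_on)
  have eq: "measure lebesgue U = measure lborel U" if "compact U" for U :: "(real^'n) set"
    using that by (simp add: compact_imp_closed measure_completion borel_closed)
  have "emeasure lborel ((*v) M ` S) * emeasure lborel T
       = emeasure lborel ((*v) M ` T) * emeasure lborel S"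
    using assms(2,3)
    by (intro emeasure_linear_image_ratio[where g = "(*v) N"])
       (auto simp: inv borel_closed compact_imp_closed)
  then have "enn2real (emeasure lborel ((*v) M ` S) * emeasure lborel T)
       = enn2real (emeasure lborel ((*v) M ` T) * emeasure lborel S)"
    by simp
  then show ?thesis
    unfolding eq[OF assms(2)] eq[OF assms(3)] eq[OF comp[OF assms(2)]] eq[OF comp[OF assms(3)]]
    by (simp add: measure_def enn2real_mult)
qed

section \<open>Haar null sets on a sphere\<close>

text \<open>If the null set contained a cap of the sphere, all caps of that radius would be null, since
  orthogonal maps act transitively and preserve the measure; but finitely many of them cover the
  sphere, which has measure \<open>1\<close>.\<close>

lemma sphere_haar_null_compact_imp_codense:
  fixes c :: "real^'n"
  assumes haar: "sphere_haar c r \<sigma>" and "compact N" "N \<subseteq> sphere c r" "emeasure \<sigma> N = 0"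
    and x: "x \<in> sphere c r" and "e > 0"
  shows "\<exists>y\<in>sphere c r. y \<notin> N \<and> dist x y < e"
proof (rule ccontr)
  assume contra: "\<not> ?thesis"
  have sets: "sets \<sigma> = sets (restrict_space borel (sphere c r))"
    and inv: "\<And>f. orthogonal_transformation f \<Longrightarrow> distr \<sigma> \<sigma> (\<lambda>x. c + f (x - c)) = \<sigma>"
    and "prob_space \<sigma>"
    using haar by (auto simp: sphere_haar_def)
  interpret prob_space \<sigma> by fact
  have space: "space \<sigma> = sphere c r"
    using sets_eq_imp_space_eq[OF sets] by (simp add: space_restrict_space)
  have in_sets: "S \<in> sets \<sigma>" if "S \<in> sets borel" "S \<subseteq> sphere c r" for S
    using that by (simp add: sets sets_restrict_space_iff)
  define cap where "cap w = sphere c r \<inter> ball w e" for w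
  have cap_sets: "cap w \<in> sets \<sigma>" for w
    by (rule in_sets) (auto simp: cap_def)
  have "N \<in> null_sets \<sigma>"
    using assms by (intro null_setsI in_sets) (auto simp: compact_imp_closed borel_closed)
  moreover have "cap x \<subseteq> N"
    using contra by (auto simp: cap_def)
  ultimately have cap_x: "emeasure \<sigma> (cap x) = 0"
    using cap_sets null_sets_subset by (meson null_setsD1)
  have cap_null: "cap w \<in> null_sets \<sigma>" if w: "w \<in> sphere c r" for w
  proof -
    have "norm (w - c) = norm (x - c)"
      using w x by (simp add: dist_norm norm_minus_commute)
    then obtain f where f: "orthogonal_transformation f" "f (w - c) = x - c"
      by (rule orthogonal_transformation_exists)
    define T where "T z = c + f (z - c)" for z
    have "linear f"
      using f(1) by (rule orthogonal_transformation_linear)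
    have dist_T: "dist (T y) (T z) = dist y z" for y z
      using f(1) by (simp add: T_def dist_norm orthogonal_transformation_norm
          flip: linear_diff[OF \<open>linear f\<close>])
    have "T c = c" "T w = x"
      using f(2) by (simp_all add: T_def linear_0[OF \<open>linear f\<close>])
    have "T \<in> borel_measurable borel"
      unfolding T_def
      by (intro borel_measurable_continuous_onI continuous_intros
          bounded_linear.continuous_on[OF linear_conv_bounded_linear[THEN iffD1, OF \<open>linear f\<close>]])
    then have T: "T \<in> measurable \<sigma> \<sigma>"
      using dist_T[of c] \<open>T c = c\<close> sets
      by (subst measurable_cong_sets[OF sets sets])
         (auto intro!: measurable_restrict_space3)
    have "cap w = T -` cap x \<inter> space \<sigma>"
      using dist_T[of c] dist_T[of w] \<open>T c = c\<close> \<open>T w = x\<close> by (auto simp: cap_def space)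
    then have "emeasure \<sigma> (cap w) = emeasure (distr \<sigma> \<sigma> T) (cap x)"
      using T cap_sets by (simp add: emeasure_distr)
    then show ?thesis
      using inv[OF f(1)] cap_x cap_sets by (auto simp: T_def[abs_def])
  qed
  have "compact (sphere c r)"
    by simp
  then obtain W where W: "finite W" "W \<subseteq> sphere c r" "sphere c r \<subseteq> (\<Union>w\<in>W. ball w e)"
    using seq_compact_imp_totally_bounded[of "sphere c r"] \<open>e > 0\<close>
    by (auto simp: compact_eq_seq_compact_metric)
  have "sphere c r = (\<Union>w\<in>W. cap w)"
    using W(3) by (auto simp: cap_def)
  moreover have "(\<Union>w\<in>W. cap w) \<in> null_sets \<sigma>"
    using W cap_null by (intro null_sets_UN') (auto intro: countable_finite)
  ultimately show False
    using emeasure_space_1 by (auto simp: space)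
qed

section \<open>Rotating finitely many points off a set with empty interior\<close>

text \<open>A reflection only if \<open>v\<close> is a unit vector: the formula leaves out the division by \<open>v \<bullet> v\<close>.\<close>

definition hyperplane_reflection :: "'a::euclidean_space \<Rightarrow> 'a \<Rightarrow> 'a" where
  "hyperplane_reflection v z = z - (2 * (z \<bullet> v)) *\<^sub>R v"

lemma orthogonal_transformation_hyperplane_reflection:
  assumes "norm v = 1"
  shows "orthogonal_transformation (hyperplane_reflection v)"
proof -
  have "v \<bullet> v = 1"
    using assms by (simp add: norm_eq_1)
  then show ?thesis
    unfolding orthogonal_transformation_def hyperplane_reflection_def
    by (auto intro!: linearI simp: inner_diff_left inner_diff_right inner_add_left inner_commute algebra_simps)
qed

text \<open>Any two reflections are conjugate by an orthogonal map, so they have the same determinant, and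
  its square is \<open>1\<close>.\<close>

lemma det_comp_hyperplane_reflections:
  fixes v w :: "real^'n"
  assumes "norm v = 1" "norm w = 1"
  shows "det (matrix (hyperplane_reflection v \<circ> hyperplane_reflection w)) = 1"
proof -
  have "norm w = norm v"
    using assms by simp
  then obtain q where q: "orthogonal_transformation q" "q w = v"
    by (rule orthogonal_transformation_exists)
  have lin: "linear q" "linear (hyperplane_reflection v)" "linear (hyperplane_reflection w)"
    using assms q by (simp_all add: orthogonal_transformation_linear orthogonal_transformation_hyperplane_reflection)
  have "hyperplane_reflection v \<circ> q = q \<circ> hyperplane_reflection w"
    using q(1) by (auto simp: hyperplane_reflection_def fun_eq_iff linear_diff[OF lin(1)] linear_cmul[OF lin(1)]
        orthogonal_transformation_def simp flip: q(2))
  then have "det (matrix (hyperplane_reflection v)) * det (matrix q) = det (matrix q) * det (matrix (hyperplane_reflection w))"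
    using lin by (metis matrix_compose det_mul)
  moreover have "det (matrix q) \<noteq> 0"
    using det_orthogonal_matrix[of "matrix q"] q(1) by (auto simp: orthogonal_transformation_matrix)
  ultimately have "det (matrix (hyperplane_reflection v)) = det (matrix (hyperplane_reflection w))"
    by simp
  moreover have "\<bar>det (matrix (hyperplane_reflection w))\<bar> = 1"
    using det_orthogonal_matrix[of "matrix (hyperplane_reflection w)"] orthogonal_transformation_hyperplane_reflection[OF assms(2)]
    by (auto simp: orthogonal_transformation_matrix)
  ultimately show ?thesis
    using lin by (auto simp: matrix_compose det_mul abs_if split: if_splits)
qed

text \<open>Reflecting \<open>w\<close> first to \<open>- w\<close> and then in the hyperplane orthogonal to \<open>w + y\<close> gives \<open>y\<close>. The
  point of this particular rotation is that it depends continuously on \<open>y\<close> and becomes the identity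
  at \<open>y = w\<close>.\<close>

lemma small_rotation:
  fixes w :: "real^'n"
  assumes "norm w = 1" "norm y = 1" "w + y \<noteq> 0"
  defines "f \<equiv> hyperplane_reflection (sgn (w + y)) \<circ> hyperplane_reflection w"
  shows "orthogonal_transformation f" "det (matrix f) = 1" "f w = y"
proof -
  have s: "norm (sgn (w + y)) = 1"
    using assms(3) by (simp add: norm_sgn)
  show "orthogonal_transformation f" "det (matrix f) = 1"
    unfolding f_def using assms s
    by (auto intro: orthogonal_transformation_compose orthogonal_transformation_hyperplane_reflection det_comp_hyperplane_reflections)
  have "w \<bullet> w = 1" "y \<bullet> y = 1"
    using assms(1,2) by (simp_all add: norm_eq_1)
  then have n: "(norm (w + y))\<^sup>2 = 2 * (w \<bullet> (w + y))"
    by (simp add: power2_norm_eq_inner inner_add_left inner_add_right inner_commute)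
  have "hyperplane_reflection w w = - w"
    using assms(1) by (simp add: hyperplane_reflection_def norm_eq_1 scaleR_2)
  then have "f w = - w + (2 * (w \<bullet> sgn (w + y))) *\<^sub>R sgn (w + y)"
    by (simp add: f_def hyperplane_reflection_def[of "sgn (w + y)"])
  also have "\<dots> = - w + (2 * (w \<bullet> (w + y)) / (norm (w + y))\<^sup>2) *\<^sub>R (w + y)"
    by (simp add: sgn_div_norm power2_eq_square divide_simps)
  also have "\<dots> = y"
    using assms(3) n[symmetric] by simp
  finally show "f w = y" .
qed

text \<open>The points of \<open>X\<close> are moved off \<open>Z\<close> one after the other. A rotation close enough to the identity
  keeps the points treated so far in the open complement of \<open>Z\<close>, and it can carry the next point to
  any nearby point of the sphere, in particular to one outside \<open>Z\<close>. Building the rotation from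
  pairs of reflections keeps its determinant equal to \<open>1\<close>, as the definition of an affine copy
  requires.\<close>

lemma rotation_avoiding_codense_set:
  fixes Z X :: "(real^'n) set"
  assumes "closed Z" and codense: "\<And>w e. norm w = 1 \<Longrightarrow> e > 0 \<Longrightarrow> \<exists>y. norm y = 1 \<and> y \<notin> Z \<and> dist w y < e"
    and "finite X" "X \<subseteq> sphere 0 1"
  shows "\<exists>f. orthogonal_transformation f \<and> det (matrix f) = 1 \<and> (\<forall>x\<in>X. f x \<notin> Z)"
  using assms(3,4)
proof (induction rule: finite_induct)
  case empty
  have "orthogonal_transformation (\<lambda>x::real^'n. x)" "det (matrix (\<lambda>x::real^'n. x)) = 1"
    by (auto simp: orthogonal_transformation_id matrix_id[unfolded id_def])
  then show ?case by blast
next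
  case (insert a X)
  then obtain f where f: "orthogonal_transformation f" "det (matrix f) = 1" "\<forall>x\<in>X. f x \<notin> Z"
    by auto
  define w where "w = f a"
  have w: "norm w = 1"
    using insert.prems f(1) by (simp add: w_def orthogonal_transformation_norm)
  define g where "g y = hyperplane_reflection (sgn (w + y)) \<circ> hyperplane_reflection w" for y
  have refl_twice: "hyperplane_reflection w (hyperplane_reflection w z) = z" for z
    using w by (simp add: hyperplane_reflection_def norm_eq_1 algebra_simps scaleR_left_distrib[symmetric])
  have "w + w \<noteq> 0"
    using w by (auto simp: scaleR_2[symmetric])
  then have sgn_lim: "((\<lambda>y. sgn (w + y)) \<longlongrightarrow> sgn (w + w)) (nhds w)"
    by (intro tendsto_intros filterlim_ident)
  have "sgn (w + w) = w"
    using w by (simp add: sgn_div_norm scaleR_2[symmetric])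
  then have lim: "((\<lambda>y. g y z) \<longlongrightarrow> z) (nhds w)" for z
    using tendsto_diff[OF tendsto_const[of "hyperplane_reflection w z"]
      tendsto_scaleR[OF tendsto_mult[OF tendsto_const[of 2]
        tendsto_inner[OF tendsto_const[of "hyperplane_reflection w z"] sgn_lim]] sgn_lim]] refl_twice[of z]
    by (simp add: g_def hyperplane_reflection_def[of "sgn _"] hyperplane_reflection_def[of w "hyperplane_reflection w z"])
  have "\<forall>\<^sub>F y in nhds w. g y (f x) \<notin> Z" if "x \<in> X" for x
    using topological_tendstoD[OF lim[of "f x"], of "- Z"] \<open>closed Z\<close> f(3) that
    by (simp add: open_Compl)
  then have "\<forall>\<^sub>F y in nhds w. \<forall>x\<in>X. g y (f x) \<notin> Z"
    using \<open>finite X\<close> by (simp add: eventually_ball_finite)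
  moreover have "\<forall>\<^sub>F y in nhds w. w + y \<noteq> 0"
    using \<open>w + w \<noteq> 0\<close> by (intro tendsto_imp_eventually_ne[of _ "w + w"] tendsto_intros filterlim_ident)
  ultimately have "\<forall>\<^sub>F y in nhds w. (\<forall>x\<in>X. g y (f x) \<notin> Z) \<and> w + y \<noteq> 0"
    by (rule eventually_conj)
  then obtain e where e: "e > 0" "\<And>y. dist y w < e \<Longrightarrow> (\<forall>x\<in>X. g y (f x) \<notin> Z) \<and> w + y \<noteq> 0"
    unfolding eventually_nhds_metric by blast
  obtain y where y: "norm y = 1" "y \<notin> Z" "dist w y < e"
    using codense[OF w e(1)] by blast
  note gy = small_rotation[OF w y(1), folded g_def]
  have "w + y \<noteq> 0" "\<forall>x\<in>X. g y (f x) \<notin> Z"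
    using e(2)[of y] y(3) by (auto simp: dist_commute)
  then have "orthogonal_transformation (g y \<circ> f)" "det (matrix (g y \<circ> f)) = 1"
    "\<forall>x\<in>insert a X. (g y \<circ> f) x \<notin> Z"
    using gy f y(2)
    by (auto simp: orthogonal_transformation_compose matrix_compose orthogonal_transformation_linear det_mul w_def)
  then show ?case by blast
qed

section \<open>Room inside few half-spaces tangent to the unit ball\<close>

text \<open>After a rotation \<open>f\<close>, each normal \<open>f x\<close> lies outside \<open>L\<close>, or satisfies \<open>f x \<bullet> u < 0\<close>. In the first
  case \<open>f x \<bullet> k < 1\<close> on \<open>L\<close>, because a vector of the unit ball with inner product \<open>1\<close> with a unit
  vector equals that vector; compactness leaves room for a small translation. In the second case
  every translation by a positive multiple of \<open>u\<close> makes \<open>f x \<bullet> k \<le> 1\<close> strict. The matrix \<open>A\<close> is the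
  transpose of \<open>f\<close>, which moves the rotation from the normals to \<open>L\<close>.\<close>

lemma rotation_into_open_halfspaces:
  fixes L :: "(real^'n) set"
  assumes "compact L" and L1: "L \<subseteq> cball 0 1"
    and codense: "\<And>w e. norm w = 1 \<Longrightarrow> e > 0 \<Longrightarrow> \<exists>y. norm y = 1 \<and> \<not> (y \<in> L \<and> 0 \<le> y \<bullet> u) \<and> dist w y < e"
    and X: "finite X" "X \<subseteq> sphere 0 1"
  shows "\<exists>A t m. orthogonal_matrix A \<and> det A = 1 \<and> m < 1 \<and> (\<forall>x\<in>X. \<forall>k\<in>L. x \<bullet> (A *v k + t) < m)"
proof -
  have "closed (L \<inter> {y. 0 \<le> y \<bullet> u})"
    using \<open>compact L\<close> by (intro closed_Int compact_imp_closed closed_Collect_le continuous_intros)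
  then obtain f where f: "orthogonal_transformation f" "det (matrix f) = 1"
    and avoid: "\<And>x. x \<in> X \<Longrightarrow> f x \<notin> L \<inter> {y. 0 \<le> y \<bullet> u}"
    using rotation_avoiding_codense_set[OF _ _ X, of "L \<inter> {y. 0 \<le> y \<bullet> u}"] codense by force
  have push: "\<forall>\<^sub>F \<epsilon> in at_right 0. \<forall>k\<in>L. f x \<bullet> (k + \<epsilon> *\<^sub>R u) < 1" if "x \<in> X" for x
  proof -
    have fx: "norm (f x) = 1"
      using that X f(1) by (auto simp: orthogonal_transformation_norm)
    have le1: "f x \<bullet> k \<le> 1" if "k \<in> L" for k
      using norm_cauchy_schwarz[of "f x" k] L1 that fx by auto
    show ?thesis
    proof (cases "f x \<in> L")
      case True
      then have "f x \<bullet> u < 0"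
        using avoid[OF that] by auto
      have "f x \<bullet> (k + \<epsilon> *\<^sub>R u) < 1" if "\<epsilon> > 0" "k \<in> L" for \<epsilon> k
        using mult_pos_neg[OF that(1) \<open>f x \<bullet> u < 0\<close>] le1[OF that(2)]
        by (simp add: inner_add_right)
      then show ?thesis
        by (auto simp: eventually_at_right_less intro: eventually_mono[OF eventually_at_right_less])
    next
      case False
      show ?thesis
      proof (cases "L = {}")
        case nonempty: False
        then obtain k0 where k0: "k0 \<in> L" "\<And>k. k \<in> L \<Longrightarrow> f x \<bullet> k \<le> f x \<bullet> k0"
          using continuous_attains_sup[OF \<open>compact L\<close> _ continuous_on_inner[OF continuous_on_const continuous_on_id]]
          by blast
        have "f x \<bullet> k0 \<noteq> 1"
        proof
          assume "f x \<bullet> k0 = 1"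
          moreover have "(norm k0)\<^sup>2 \<le> 1"
            using L1 k0(1) by (auto simp: power_le_one)
          ultimately have "(norm (f x - k0))\<^sup>2 \<le> 0"
            using fx by (simp add: power2_norm_eq_inner norm_eq_1 inner_diff_left inner_diff_right inner_commute)
          then show False
            using k0(1) False by simp
        qed
        then have "f x \<bullet> k0 < 1"
          using le1[OF k0(1)] by simp
        moreover have "((\<lambda>\<epsilon>. f x \<bullet> k0 + \<epsilon> * (f x \<bullet> u)) \<longlongrightarrow> f x \<bullet> k0 + 0 * (f x \<bullet> u)) (at_right 0)"
          by (intro tendsto_intros)
        ultimately have "\<forall>\<^sub>F \<epsilon> in at_right 0. f x \<bullet> k0 + \<epsilon> * (f x \<bullet> u) < 1"
          by (intro order_tendstoD) auto
        then show ?thesis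
          by eventually_elim (use k0(2) in \<open>fastforce simp: inner_add_right\<close>)
      qed simp
    qed
  qed
  then have "\<forall>\<^sub>F \<epsilon> in at_right 0. \<forall>x\<in>X. \<forall>k\<in>L. f x \<bullet> (k + \<epsilon> *\<^sub>R u) < 1"
    using X(1) by (simp add: eventually_ball_finite)
  then have "\<exists>\<epsilon>. \<forall>x\<in>X. \<forall>k\<in>L. f x \<bullet> (k + \<epsilon> *\<^sub>R u) < 1"
    by (rule eventually_happens'[rotated]) simp
  then obtain \<epsilon> where \<epsilon>: "\<And>x k. x \<in> X \<Longrightarrow> k \<in> L \<Longrightarrow> f x \<bullet> (k + \<epsilon> *\<^sub>R u) < 1"
    by blast
  define A where "A = transpose (matrix f)"
  define t where "t = A *v (\<epsilon> *\<^sub>R u)"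
  have A: "orthogonal_matrix A" "det A = 1"
    using f by (simp_all add: A_def orthogonal_transformation_matrix)
  have adj: "x \<bullet> (A *v z) = f x \<bullet> z" for x z
  proof -
    have "x \<bullet> (A *v z) = (x v* A) \<bullet> z"
      by (simp only: dot_lmul_matrix)
    also have "\<dots> = f x \<bullet> z"
      using f(1) by (simp add: A_def matrix_works orthogonal_transformation_linear)
    finally show ?thesis .
  qed
  have lt1: "x \<bullet> (A *v k + t) < 1" if "x \<in> X" "k \<in> L" for x k
    using \<epsilon>[OF that] by (simp add: t_def adj inner_add_right)
  have "\<exists>m<1. \<forall>x\<in>X. \<forall>k\<in>L. x \<bullet> (A *v k + t) < m"
  proof (cases "X \<times> L = {}")
    case False
    have "compact (X \<times> L)"
      using finite_imp_compact[OF X(1)] \<open>compact L\<close> by (rule compact_Times)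
    moreover have "continuous_on (X \<times> L) (\<lambda>(x, k). x \<bullet> (A *v k + t))"
      unfolding case_prod_unfold
      by (intro continuous_intros bounded_linear.continuous_on[OF matrix_vector_mul_bounded_linear])
    ultimately obtain p where p: "p \<in> X \<times> L"
      "\<forall>q\<in>X \<times> L. (\<lambda>(x, k). x \<bullet> (A *v k + t)) q \<le> (\<lambda>(x, k). x \<bullet> (A *v k + t)) p"
      using continuous_attains_sup[OF _ False] by blast
    define m where "m = (\<lambda>(x, k). x \<bullet> (A *v k + t)) p"
    have "m < 1"
      using p(1) lt1 by (auto simp: m_def)
    then show ?thesis
      using p(2) by (intro exI[of _ "(1 + m) / 2"]) (fastforce simp flip: m_def)
  qed (auto intro: exI[of _ 0])
  then show ?thesis
    using A by blast
qed

lemma open_inner_less_compact: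
  fixes C :: "'a::euclidean_space set"
  assumes "compact C"
  shows "open {x. \<forall>y\<in>C. x \<bullet> y < m}"
proof -
  have "closed {p :: 'a \<times> 'a. m \<le> snd p \<bullet> fst p}"
    by (intro closed_Collect_le continuous_intros)
  from closed_compact_projection[OF assms this]
  show ?thesis
    by (simp add: open_closed Collect_neg_eq[symmetric] not_less Bex_def)
qed

text \<open>For a fixed motion \<open>(A, t)\<close> and bound, the condition on the normals is open, so finitely many
  triples \<open>(A, t, m)\<close> serve for all sequences of unit vectors, which form a compact space by
  Tychonoff's theorem; the largest bound among them works throughout.\<close>

lemma uniform_rotation_into_halfspaces:
  fixes L :: "(real^'n) set"
  assumes "compact L" "L \<subseteq> cball 0 1"
    and "\<And>w e. norm w = 1 \<Longrightarrow> e > 0 \<Longrightarrow> \<exists>y. norm y = 1 \<and> \<not> (y \<in> L \<and> 0 \<le> y \<bullet> u) \<and> dist w y < e"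
  obtains m where "0 < m" "m < 1"
    "\<And>X. finite X \<Longrightarrow> X \<subseteq> sphere 0 1 \<Longrightarrow> card X \<le> n \<Longrightarrow>
       \<exists>A t. orthogonal_matrix A \<and> det A = 1 \<and> (\<forall>x\<in>X. \<forall>k\<in>L. x \<bullet> (A *v k + t) \<le> m)"
proof -
  define S where "S = (\<Pi>\<^sub>E i\<in>(UNIV::nat set). sphere (0::real^'n) 1)"
  define J where "J = {(A :: real^'n^'n, t :: real^'n, m :: real). orthogonal_matrix A \<and> det A = 1 \<and> m < 1}"
  define U where "U = (\<lambda>(A :: real^'n^'n, t :: real^'n, m :: real). {x. \<forall>y\<in>(\<lambda>k. A *v k + t) ` L. x \<bullet> y < m})"
  define V where "V j = (\<Inter>i<n. (\<lambda>q::nat \<Rightarrow> real^'n. q i) -` U j)" for j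
  have "compact S"
    using compactin_PiE[of "\<lambda>i. euclidean" UNIV "\<lambda>i. sphere (0::real^'n) 1"]
    by (simp add: S_def euclidean_product_topology)
  have "open (U j)" for j
    unfolding U_def case_prod_unfold using \<open>compact L\<close>
    by (intro open_inner_less_compact compact_continuous_image continuous_intros)
  then have "open (V j)" for j
    unfolding V_def by (intro open_INT ballI open_vimage continuous_on_product_coordinates) auto
  moreover have "S \<subseteq> (\<Union>j\<in>J. V j)"
  proof
    fix q assume "q \<in> S"
    then have "q ` {..<n} \<subseteq> sphere 0 1"
      by (auto simp: S_def)
    then obtain A t m where "orthogonal_matrix A" "det A = 1" "m < 1" "\<forall>x\<in>q ` {..<n}. \<forall>k\<in>L. x \<bullet> (A *v k + t) < m"
      using rotation_into_open_halfspaces[OF assms, of "q ` {..<n}"] by blast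
    then have "(A, t, m) \<in> J" "q \<in> V (A, t, m)"
      by (auto simp: J_def V_def U_def)
    then show "q \<in> (\<Union>j\<in>J. V j)" by blast
  qed
  ultimately obtain J' where J': "J' \<subseteq> J" "finite J'" "S \<subseteq> (\<Union>j\<in>J'. V j)"
    using compactE_image[OF \<open>compact S\<close>, of J V] by blast
  \<comment> \<open>The entry \<open>1/2\<close> makes \<open>m\<close> positive, and the set nonempty even if \<open>J'\<close> is empty.\<close>
  define m where "m = Max (insert (1/2) ((\<lambda>(A, t, m). m) ` J'))"
  show thesis
  proof
    show "0 < m"
      using J'(2) by (auto simp: m_def less_max_iff_disj Max_gr_iff)
    show "m < 1"
      using J'(1,2) by (auto simp: m_def J_def)
    fix X :: "(real^'n) set"
    assume X: "finite X" "X \<subseteq> sphere 0 1" "card X \<le> n"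
    obtain h where h: "bij_betw h {0..<card X} X"
      using ex_bij_betw_nat_finite[OF X(1)] by blast
    \<comment> \<open>Positions beyond the cardinality of \<open>X\<close> are filled with an arbitrary unit vector.\<close>
    define q where "q i = (if i < card X then h i else axis undefined 1)" for i
    have "X \<subseteq> q ` {..<n}"
    proof
      fix x assume "x \<in> X"
      then obtain i where "i < card X" "h i = x"
        using h by (force simp: bij_betw_def)
      then show "x \<in> q ` {..<n}"
        using X(3) by (auto simp: q_def intro!: image_eqI[of _ _ i])
    qed
    have "h i \<in> sphere 0 1" if "i < card X" for i
      using that X(2) bij_betwE[OF h] by (meson atLeastLessThan_iff le0 subsetD)
    then have "q \<in> S"
      by (auto simp: S_def q_def)
    then obtain A t m' where j: "(A, t, m') \<in> J'" "q \<in> V (A, t, m')"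
      using J'(3) by auto
    have "m' \<le> m"
      using j(1) J'(2) by (auto simp: m_def intro!: Max_ge image_eqI[of _ _ "(A, t, m')"])
    moreover have "x \<bullet> (A *v k + t) < m'" if "x \<in> X" "k \<in> L" for x k
      using that j(2) \<open>X \<subseteq> q ` {..<n}\<close> by (fastforce simp: V_def U_def)
    ultimately show "\<exists>A t. orthogonal_matrix A \<and> det A = 1 \<and> (\<forall>x\<in>X. \<forall>k\<in>L. x \<bullet> (A *v k + t) \<le> m)"
      using j(1) J'(1) by (intro exI[of _ A] exI[of _ t]) (force simp: J_def)
  qed
qed

section \<open>Volumes of affine copies\<close>

text \<open>The scaling factor of \<open>\<beta> *\<^sub>R A\<close> is read off from the unit ball, which \<open>A\<close> preserves.\<close>

lemma measure_scaled_rotation_image: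
  fixes A :: "real^'n^'n"
  assumes A: "orthogonal_matrix A" and "\<beta> > 0" and "compact K"
  shows "measure lebesgue ((*v) (\<beta> *\<^sub>R A) ` K) = \<beta> ^ CARD('n) * measure lebesgue K"
proof -
  have inv: "invertible (\<beta> *\<^sub>R A)"
    using A \<open>\<beta> > 0\<close> by (intro scalar_invertible) (auto simp: invertible_def orthogonal_matrix_def)
  have "orthogonal_transformation ((*v) A)"
    using A by (simp add: orthogonal_transformation_matrix)
  then have "(*v) A ` (*\<^sub>R) \<beta> ` cball 0 1 = cball 0 \<beta>"
    using \<open>\<beta> > 0\<close> cball_scale[of \<beta> "0::real^'n" 1]
    by (simp add: image_orthogonal_transformation_cball)
  then have "(*v) (\<beta> *\<^sub>R A) ` cball 0 1 = cball 0 \<beta>"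
    by (simp add: image_image matrix_vector_mult_scaleR scaleR_matrix_vector_assoc)
  then have "measure lebesgue ((*v) (\<beta> *\<^sub>R A) ` K) * unit_ball_vol CARD('n)
      = unit_ball_vol CARD('n) * \<beta> ^ CARD('n) * measure lebesgue K"
    using measure_matrix_image_ratio[OF inv \<open>compact K\<close> compact_cball[of 0 1]] \<open>\<beta> > 0\<close>
    by (simp add: content_cball)
  moreover have "unit_ball_vol (real CARD('n)) > 0"
    by simp
  ultimately show ?thesis
    by (simp del: unit_ball_vol_pos)
qed

text \<open>The preimage \<open>E\<close> of \<open>cball 0 s\<close> under the affine map is an ellipsoid containing \<open>K\<close>, so its volume is at least that of
  \<open>cball c r\<close>, and the linear part \<open>M\<close> scales \<open>K\<close> and \<open>E\<close> by the same factor.\<close>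

lemma measure_copy_in_cball_le:
  fixes K :: "(real^'n) set" and M :: "real^'n^'n"
  assumes "compact K" and min: "min_volume_ellipsoid K (cball c r)" and "r > 0"
    and M: "invertible M" and sub: "(\<lambda>x. a + M *v x) ` K \<subseteq> cball 0 s" and "s > 0"
  shows "measure lebesgue ((*v) M ` K) \<le> (s / r) ^ CARD('n) * measure lebesgue K"
proof -
  define \<omega> where "\<omega> = unit_ball_vol (real CARD('n))"
  have "\<omega> > 0"
    by (simp add: \<omega>_def)
  obtain N where N: "M ** N = mat 1" "N ** M = mat 1"
    using M by (auto simp: invertible_def)
  have inv: "M *v (N *v x) = x" "N *v (M *v x) = x" for x
    by (simp_all add: matrix_vector_mul_assoc N)
  define E where "E = (\<lambda>x. - (N *v a) + (s *\<^sub>R N) *v x) ` cball 0 1"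
  have "invertible (s *\<^sub>R N)"
    using N \<open>s > 0\<close> by (intro scalar_invertible) (auto simp: invertible_def)
  then have "is_ellipsoid E"
    unfolding is_ellipsoid_def E_def by blast
  moreover have "K \<subseteq> E"
  proof
    fix x assume "x \<in> K"
    then have "norm (a + M *v x) \<le> s"
      using sub by auto
    then have "(1 / s) *\<^sub>R (a + M *v x) \<in> cball 0 1"
      using \<open>s > 0\<close> by simp
    moreover have "x = - (N *v a) + (s *\<^sub>R N) *v ((1 / s) *\<^sub>R (a + M *v x))"
      using \<open>s > 0\<close> by (simp add: matrix_vector_mult_scaleR scaleR_matrix_vector_assoc[symmetric]
          matrix_vector_right_distrib inv scaleR_right_distrib)
    ultimately show "x \<in> E"
      unfolding E_def by blast
  qed
  ultimately have "measure lebesgue (cball c r) \<le> measure lebesgue E"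
    using min by (auto simp: min_volume_ellipsoid_def)
  then have le: "\<omega> * r ^ CARD('n) \<le> measure lebesgue E"
    using \<open>r > 0\<close> by (simp add: content_cball \<omega>_def)
  have "compact E"
    unfolding E_def by (intro compact_continuous_image continuous_intros compact_cball)
  have "(*v) M ` E = (\<lambda>x. - a + s *\<^sub>R x) ` cball 0 1"
    unfolding E_def image_image
    by (intro image_cong) (simp_all add: matrix_vector_right_distrib matrix_vector_mult_diff_distrib inv
        scaleR_matrix_vector_assoc[symmetric] matrix_vector_mult_scaleR)
  also have "\<dots> = cball (- a) s"
    using \<open>s > 0\<close> cball_scale[of s "0::real^'n" 1] image_add_cball[of "- a" 0 s]
    by (simp only: image_image[of "(+) (- a)" "(*\<^sub>R) s", symmetric]) simp
  finally have "measure lebesgue ((*v) M ` K) * measure lebesgue E = \<omega> * s ^ CARD('n) * measure lebesgue K"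
    using measure_matrix_image_ratio[OF M \<open>compact K\<close> \<open>compact E\<close>] \<open>s > 0\<close>
    by (simp add: content_cball \<omega>_def)
  moreover have "measure lebesgue ((*v) M ` K) * (\<omega> * r ^ CARD('n)) \<le> measure lebesgue ((*v) M ` K) * measure lebesgue E"
    using le by (intro mult_left_mono) auto
  ultimately have "\<omega> * (measure lebesgue ((*v) M ` K) * r ^ CARD('n)) \<le> \<omega> * (s ^ CARD('n) * measure lebesgue K)"
    by (simp add: mult_ac)
  then show ?thesis
    using \<open>\<omega> > 0\<close> \<open>r > 0\<close> by (simp add: power_divide pos_le_divide_eq)
qed

text \<open>Ellipsoids are images of the unit ball under injective maps, whereas a ball of nonpositive radius
  has at most one point.\<close>

lemma radius_pos_if_is_ellipsoid:
  fixes c :: "real^'n"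
  assumes "is_ellipsoid (cball c r)"
  shows "r > 0"
proof (rule ccontr)
  assume "\<not> r > 0"
  then have single: "cball c r \<subseteq> {c}"
    using dist_le_zero_iff[of c] by (fastforce simp: not_less)
  obtain a and M :: "real^'n^'n" where M: "invertible M" "cball c r = (\<lambda>x. a + M *v x) ` cball 0 1"
    using assms by (auto simp: is_ellipsoid_def)
  define e :: "real^'n" where "e = axis undefined 1"
  have e: "norm e = 1"
    by (simp add: e_def)
  have "(\<lambda>x. a + M *v x) ` cball 0 1 \<subseteq> {c}"
    using M(2) single by simp
  then have "\<forall>x\<in>cball 0 1. a + M *v x = c"
    by (simp add: image_subset_iff)
  then have "a + M *v 0 = c" "a + M *v e = c"
    using e by (metis mem_cball_0 norm_zero zero_le_one, metis mem_cball_0 order_refl)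
  then have "M *v e = M *v 0"
    by simp
  moreover obtain N where "N ** M = mat 1"
    using M(1) by (auto simp: invertible_def)
  ultimately have "e = 0"
    by (metis matrix_vector_mul_assoc matrix_vector_mul_lid)
  then show False
    using e by simp
qed

lemma affine_copy_eq_translate:
  "(\<lambda>x. a + \<alpha> *\<^sub>R (A *v x)) ` K = (+) a ` (*v) (\<alpha> *\<^sub>R A) ` K" for A :: "real^'n^'n"
  by (simp add: image_image scaleR_matrix_vector_assoc)

lemma emeasure_affine_copy:
  fixes A :: "real^'n^'n"
  assumes "compact K"
  shows "emeasure lebesgue ((\<lambda>x. a + \<alpha> *\<^sub>R (A *v x)) ` K)
       = ennreal (measure lebesgue ((*v) (\<alpha> *\<^sub>R A) ` K))"
proof -
  have "compact ((\<lambda>x. a + \<alpha> *\<^sub>R (A *v x)) ` K)"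
    using assms by (intro compact_continuous_image continuous_intros)
  then have "emeasure lebesgue ((\<lambda>x. a + \<alpha> *\<^sub>R (A *v x)) ` K)
      = ennreal (measure lebesgue ((\<lambda>x. a + \<alpha> *\<^sub>R (A *v x)) ` K))"
    by (intro emeasure_eq_measure2 lmeasurable_compact)
  then show ?thesis
    unfolding affine_copy_eq_translate by (simp add: measure_translation)
qed

text \<open>Excludes the degenerate copies, with \<open>\<alpha> = 0\<close>, and sets \<open>K\<close> of volume \<open>0\<close>.\<close>

lemma affine_copy_of_large_volume:
  fixes A :: "real^'n^'n"
  assumes "compact K" "det A = 1" "1 \<le> emeasure lebesgue ((\<lambda>x. a + \<alpha> *\<^sub>R (A *v x)) ` K)"
  shows "invertible (\<alpha> *\<^sub>R A)" "measure lebesgue ((*v) (\<alpha> *\<^sub>R A) ` K) \<ge> 1" "measure lebesgue K > 0"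
proof -
  show ge1: "measure lebesgue ((*v) (\<alpha> *\<^sub>R A) ` K) \<ge> 1"
    using assms(3) unfolding emeasure_affine_copy[OF assms(1)] by simp
  have "\<alpha> \<noteq> 0"
  proof
    assume "\<alpha> = 0"
    then have "(*v) (\<alpha> *\<^sub>R A) ` K \<subseteq> {0}"
      by (auto simp: scaleR_matrix_vector_assoc[symmetric])
    then have "negligible ((*v) (\<alpha> *\<^sub>R A) ` K)"
      by (rule negligible_subset[rotated]) simp
    then show False
      using ge1 by (simp add: negligible_imp_measure0)
  qed
  then show inv: "invertible (\<alpha> *\<^sub>R A)"
    using assms(2) by (intro scalar_invertible) (auto simp: invertible_det_nz)
  show "measure lebesgue K > 0"
  proof (rule ccontr)
    assume "\<not> ?thesis"
    then have "measure lebesgue K = 0"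
      using measure_nonneg[of lebesgue K] by linarith
    then have "measure lebesgue ((*v) (\<alpha> *\<^sub>R A) ` K) * measure lebesgue (cball (0::real^'n) 1) = 0"
      using measure_matrix_image_ratio[OF inv assms(1) compact_cball[of 0 1]] by simp
    then show False
      using ge1 by simp
  qed
qed

section \<open>Failure of the Helly property\<close>

lemma normalised_contact_points_codense:
  fixes c :: "real^'n"
  assumes "compact K" "sphere_haar c r \<sigma>" "emeasure \<sigma> (K \<inter> closed_half_sphere c r u) = 0" "r > 0"
    and "norm w = 1" "e > 0"
  shows "\<exists>y. norm y = 1 \<and> \<not> (y \<in> (\<lambda>x. (x - c) /\<^sub>R r) ` K \<and> 0 \<le> y \<bullet> u) \<and> dist w y < e"
proof -
  let ?N = "K \<inter> closed_half_sphere c r u"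
  have "closed_half_sphere c r u = sphere c r \<inter> {x. 0 \<le> (x - c) \<bullet> u}"
    by (auto simp: closed_half_sphere_def)
  then have "compact ?N"
    using \<open>compact K\<close>
    by (auto intro!: compact_Int_closed closed_Int closed_Collect_le continuous_intros)
  moreover have "?N \<subseteq> sphere c r"
    by (auto simp: closed_half_sphere_def)
  moreover have "c + r *\<^sub>R w \<in> sphere c r" "r * e > 0"
    using assms by (simp_all add: dist_norm)
  ultimately obtain z where z: "z \<in> sphere c r" "z \<notin> ?N" "dist (c + r *\<^sub>R w) z < r * e"
    using sphere_haar_null_compact_imp_codense[OF assms(2) _ _ assms(3)] by blast
  define y where "y = (z - c) /\<^sub>R r"
  have zy: "z = c + r *\<^sub>R y"
    using \<open>r > 0\<close> by (simp add: y_def)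
  have "norm y = 1"
    using z(1) \<open>r > 0\<close> by (simp add: zy dist_norm)
  moreover have "r * dist w y < r * e"
    using z(3) \<open>r > 0\<close> by (simp add: zy dist_norm flip: scaleR_diff_right)
  moreover have "\<not> (y \<in> (\<lambda>x. (x - c) /\<^sub>R r) ` K \<and> 0 \<le> y \<bullet> u)"
  proof
    assume y: "y \<in> (\<lambda>x. (x - c) /\<^sub>R r) ` K \<and> 0 \<le> y \<bullet> u"
    then have "z \<in> K"
      using \<open>r > 0\<close> by (auto simp: zy)
    moreover have "0 \<le> (z - c) \<bullet> u"
      using y \<open>r > 0\<close> by (simp add: zy)
    ultimately show False
      using z(1,2) by (simp add: closed_half_sphere_def)
  qed
  ultimately show ?thesis
    using \<open>r > 0\<close> by auto
qed

text \<open>Some net point \<open>x\<close> is \<open>\<eta>\<close>-close to the direction of \<open>z\<close>, and then \<open>x \<bullet> z\<close> is at least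
  \<open>(1 - \<eta>) * norm z\<close>.\<close>

lemma halfspaces_over_net_subset_cball:
  fixes Y :: "'a::euclidean_space set"
  assumes net: "sphere 0 1 \<subseteq> (\<Union>x\<in>Y. ball x \<eta>)" and "\<eta> < 1" "h \<ge> 0"
    and z: "\<And>x. x \<in> Y \<Longrightarrow> x \<bullet> z \<le> h"
  shows "z \<in> cball 0 (h / (1 - \<eta>))"
proof (cases "z = 0")
  case True
  then show ?thesis using assms by simp
next
  case False
  then have "sgn z \<in> sphere 0 1"
    by (simp add: norm_sgn)
  then obtain x where x: "x \<in> Y" "norm (sgn z - x) < \<eta>"
    using net by (auto simp: dist_norm norm_minus_commute)
  have "norm z = sgn z \<bullet> z"
    using False by (simp add: sgn_div_norm power2_norm_eq_inner[symmetric] power2_eq_square)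
  also have "\<dots> = x \<bullet> z + (sgn z - x) \<bullet> z"
    by (simp add: inner_diff_left)
  also have "\<dots> \<le> h + \<eta> * norm z"
    using z[OF x(1)] norm_cauchy_schwarz[of "sgn z - x" z] mult_right_mono[OF less_imp_le[OF x(2)] norm_ge_zero[of z]]
    by linarith
  finally have "norm z * (1 - \<eta>) \<le> h"
    by (simp add: algebra_simps)
  then show ?thesis
    using \<open>\<eta> < 1\<close> by (simp add: pos_le_divide_eq)
qed

text \<open>The threshold \<open>h = \<beta> * r * m\<close> is chosen so that \<open>\<beta> * r\<close> times a motion of \<open>L\<close>, a copy of \<open>K\<close> of
  volume \<open>1\<close>, fits into any \<open>n\<close> of the half-spaces, although \<open>h\<close> is smaller than its circumradius
  \<open>\<beta> * r\<close>; the volume bound for copies inside a ball therefore forbids such a copy in the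
  intersection over a fine net.\<close>

lemma not_helly_property_of_positive_volume:
  fixes K :: "(real^'n) set" and c u :: "real^'n"
  assumes "compact K" and min: "min_volume_ellipsoid K (cball c r)" and "r > 0"
    and pos: "measure lebesgue K > 0"
    and codense: "\<And>w e. norm w = 1 \<Longrightarrow> e > 0 \<Longrightarrow>
      \<exists>y. norm y = 1 \<and> \<not> (y \<in> (\<lambda>x. (x - c) /\<^sub>R r) ` K \<and> 0 \<le> y \<bullet> u) \<and> dist w y < e"
  shows "\<not> helly_property {W \<in> affine_copies K. 1 \<le> emeasure lebesgue W} n"
proof
  assume helly: "helly_property {W \<in> affine_copies K. 1 \<le> emeasure lebesgue W} n"
  define L where "L = (\<lambda>x. (x - c) /\<^sub>R r) ` K"
  have "compact L"
    unfolding L_def using \<open>compact K\<close> by (intro compact_continuous_image continuous_intros)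
  have "L \<subseteq> cball 0 1"
  proof -
    have "norm ((x - c) /\<^sub>R r) \<le> 1" if "x \<in> K" for x
    proof -
      have "x \<in> cball c r"
        using min that by (auto simp: min_volume_ellipsoid_def)
      then have "norm (x - c) \<le> r"
        by (simp add: dist_norm norm_minus_commute)
      then show ?thesis
        using \<open>r > 0\<close> by (simp add: divide_simps)
    qed
    then show ?thesis
      by (auto simp: L_def)
  qed
  obtain m where m: "0 < m" "m < 1" and
    fit: "\<And>X. finite X \<Longrightarrow> X \<subseteq> sphere 0 1 \<Longrightarrow> card X \<le> n \<Longrightarrow>
       \<exists>A t. orthogonal_matrix A \<and> det A = 1 \<and> (\<forall>x\<in>X. \<forall>k\<in>L. x \<bullet> (A *v k + t) \<le> m)"
    using uniform_rotation_into_halfspaces[OF \<open>compact L\<close> \<open>L \<subseteq> cball 0 1\<close> codense[folded L_def], of n]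
    by metis
  \<comment> \<open>The factor at which a scaled copy of \<open>K\<close> has volume exactly \<open>1\<close>.\<close>
  define \<beta> where "\<beta> = root CARD('n) (1 / measure lebesgue K)"
  have \<beta>: "\<beta> > 0" "\<beta> ^ CARD('n) * measure lebesgue K = 1"
    using pos by (simp_all add: \<beta>_def)
  \<comment> \<open>Any positive \<open>\<eta> < 1 - m\<close> works: the total intersection then lies in a ball of radius
    \<open>\<beta> * r * m / (1 - \<eta>) < \<beta> * r\<close>.\<close>
  define \<eta> where "\<eta> = (1 - m) / 2"
  have "compact (sphere (0::real^'n) 1)" "\<eta> > 0"
    using m by (simp_all add: \<eta>_def)
  then obtain Y where Y: "finite Y" "Y \<subseteq> sphere (0::real^'n) 1" "sphere 0 1 \<subseteq> (\<Union>x\<in>Y. ball x \<eta>)"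
    using seq_compact_imp_totally_bounded[of "sphere (0::real^'n) 1"]
    by (auto simp: compact_eq_seq_compact_metric)
  define h where "h = \<beta> * r * m"
  define H where "H x = {y. x \<bullet> y \<le> h}" for x :: "real^'n"
  have "contains_member {W \<in> affine_copies K. 1 \<le> emeasure lebesgue W} (\<Inter>\<G>)"
    if \<G>: "\<G> \<subseteq> H ` Y" "card \<G> \<le> n" for \<G>
  proof -
    obtain X where X: "X \<subseteq> Y" "inj_on H X" "\<G> = H ` X"
      using \<G>(1) by (auto simp: subset_image_inj)
    have X': "finite X" "X \<subseteq> sphere 0 1" "card X \<le> n"
      using X Y \<G>(2) by (auto simp: card_image intro: finite_subset)
    obtain A t where A: "orthogonal_matrix A" "det A = 1"
      and At: "\<And>x k. x \<in> X \<Longrightarrow> k \<in> L \<Longrightarrow> x \<bullet> (A *v k + t) \<le> m"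
      using fit[OF X'] by metis
    \<comment> \<open>The translation for which the copy of \<open>K\<close> is \<open>\<beta> * r\<close> times the moved copy \<open>A L + t\<close> of \<open>L\<close>.\<close>
    define a where "a = (\<beta> * r) *\<^sub>R t - \<beta> *\<^sub>R (A *v c)"
    define W where "W = (\<lambda>x. a + \<beta> *\<^sub>R (A *v x)) ` K"
    have "emeasure lebesgue W = 1"
      using \<beta> A \<open>compact K\<close> by (simp add: W_def emeasure_affine_copy measure_scaled_rotation_image)
    moreover have "W \<in> affine_copies K"
      using A(2) by (auto simp: W_def affine_copies_def)
    moreover have "W \<subseteq> \<Inter>\<G>"
    proof (clarsimp simp: X(3) W_def H_def)
      fix x z assume "x \<in> X" "z \<in> K"
      then have "x \<bullet> (A *v ((z - c) /\<^sub>R r) + t) \<le> m"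
        using At by (auto simp: L_def)
      then have "(\<beta> * r) * (x \<bullet> (A *v ((z - c) /\<^sub>R r) + t)) \<le> (\<beta> * r) * m"
        using \<beta>(1) \<open>r > 0\<close> by (intro mult_left_mono) auto
      moreover have "a + \<beta> *\<^sub>R (A *v z) = (\<beta> * r) *\<^sub>R (A *v ((z - c) /\<^sub>R r) + t)"
        using \<open>r > 0\<close> by (simp add: a_def matrix_vector_mult_scaleR matrix_vector_mult_diff_distrib
            scaleR_right_distrib scaleR_right_diff_distrib mult.assoc)
      ultimately show "x \<bullet> (a + \<beta> *\<^sub>R (A *v z)) \<le> h"
        by (simp add: h_def)
    qed
    ultimately show ?thesis
      by (auto simp: contains_member_def)
  qed
  moreover have "convex C" if "C \<in> H ` Y" for C
    using that by (auto simp: H_def convex_halfspace_le)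
  ultimately have "contains_member {W \<in> affine_copies K. 1 \<le> emeasure lebesgue W} (\<Inter>(H ` Y))"
    using Y(1) by (intro helly[unfolded helly_property_def, rule_format]) auto
  then obtain a \<alpha> and A :: "real^'n^'n" where A: "det A = 1"
    and vol: "1 \<le> emeasure lebesgue ((\<lambda>x. a + \<alpha> *\<^sub>R (A *v x)) ` K)"
    and sub: "(\<lambda>x. a + \<alpha> *\<^sub>R (A *v x)) ` K \<subseteq> \<Inter>(H ` Y)"
    by (auto simp: contains_member_def affine_copies_def)
  define s where "s = h / (1 - \<eta>)"
  have "s > 0" "s < \<beta> * r"
    using \<beta>(1) \<open>r > 0\<close> m by (auto simp: s_def h_def \<eta>_def field_simps)
  have "\<Inter>(H ` Y) \<subseteq> cball 0 s"
    unfolding s_def using m \<beta>(1) \<open>r > 0\<close>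
    by (intro subsetI halfspaces_over_net_subset_cball[OF Y(3)]) (auto simp: H_def h_def \<eta>_def)
  then have "(\<lambda>x. a + (\<alpha> *\<^sub>R A) *v x) ` K \<subseteq> cball 0 s"
    using sub by (simp add: scaleR_matrix_vector_assoc)
  note big = affine_copy_of_large_volume[OF \<open>compact K\<close> A vol]
  have "1 \<le> measure lebesgue ((*v) (\<alpha> *\<^sub>R A) ` K)"
    by (rule big(2))
  also have "\<dots> \<le> (s / r) ^ CARD('n) * measure lebesgue K"
    by (rule measure_copy_in_cball_le) fact+
  also have "\<dots> < \<beta> ^ CARD('n) * measure lebesgue K"
    using \<open>s > 0\<close> \<open>s < \<beta> * r\<close> \<open>r > 0\<close> pos
    by (intro mult_strict_right_mono power_strict_mono) (auto simp: divide_less_eq)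
  finally show False
    using \<beta>(2) by simp
qed

theorem theorem1p0p2:
  fixes K :: "(real ^ 'n) set" and c :: "real ^ 'n" and r :: real
    and \<sigma> :: "(real ^ 'n) measure"
  assumes "compact K"
    and "min_volume_ball K (cball c r)"
    and "min_volume_ellipsoid K (cball c r)"
    and "sphere_haar c r \<sigma>"
    and "\<exists>u. norm u = 1 \<and> emeasure \<sigma> (K \<inter> closed_half_sphere c r u) = 0"
  shows "\<not> exact_helly_for_volume (affine_copies K)"
proof -
  have "r > 0"
    using assms(3) radius_pos_if_is_ellipsoid by (auto simp: min_volume_ellipsoid_def)
  obtain u where u: "emeasure \<sigma> (K \<inter> closed_half_sphere c r u) = 0"
    using assms(5) by blast
  have "\<not> helly_property {W \<in> affine_copies K. 1 \<le> emeasure lebesgue W} n" for n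
  proof (cases "measure lebesgue K > 0")
    case True
    then show ?thesis
      using normalised_contact_points_codense[OF assms(1,4) u \<open>r > 0\<close>]
      by (intro not_helly_property_of_positive_volume[OF assms(1,3) \<open>r > 0\<close>])
  next
    case False
    then have empty: "{W \<in> affine_copies K. 1 \<le> emeasure lebesgue W} = {}"
      using affine_copy_of_large_volume(3)[OF \<open>compact K\<close>] by (auto simp: affine_copies_def)
    show ?thesis
      unfolding empty helly_property_def contains_member_def
      by (auto intro!: exI[of _ "{}"])
  qed
  then show ?thesis
    by (simp add: exact_helly_for_volume_def helly_number_def top_enat_def[symmetric])
qed

end
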